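(* Let $p$ be a prime and let $r$ be a nonzero residue mod $p$. Then, as $n\to\infty$, $$A_n(r)=\frac{\phi_p(n)}{p-1}+O(n^{\vartheta}),$$ where $\vartheta=\max\big(\{\mathrm{Re}(\log_p(\phi_\chi(p))):\chi\neq\chi_0\}\cup\{1\}\big)$, with $\chi$ ranging over the nonprincipal Dirichlet characters of modulus $p$. Further, the constant implied by the big $O$ is explicitly computable.
   Context: Rows of Pascal's triangle are indexed from $0$; the $u$th row consists of $\binom{u}{0},\dots,\binom{u}{u}$, and "the first $n$ rows" are rows $0,\dots,n-1$. For a fixed prime $p$: $a_u(r)$ is the number of $0\le j\le u$ with $\binom{u}{j}\equiv r \pmod p$; $A_n(r)=\sum_{u=0}^{n-1}a_u(r)$ is the number of occurrences of $r$ in the first $n$ rows of Pascal's triangle mod $p$; $\phi_p(n)$ is the number of entries in the first $n$ rows of Pascal's triangle that are nonzero mod $p$. For a Dirichlet character $\chi$ of modulus $p$ (with $\chi(0)=0$), $T_\chi(u)=\sum_{j=0}^{u}\chi\left(\binom{u}{j}\right)$ and $\phi_\chi(n)=\sum_{u=0}^{n-1}T_\chi(u)$. $\chi_0$ is the principal character mod $p$. $\log_p$ is the principal branch of the logarithm in base $p$, so $\mathrm{Re}(\log_p z)=\log_p|z|$ for $z\ne 0$; by convention this is $-\infty$ when $z=0$ (such characters do not affect the maximum). The primes $p$ and residue $r$ are fixed, and the implied constant may depend on them. *)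

theory Defs
  imports
    "HOL-Analysis.Analysis"
    "HOL-Computational_Algebra.Primes"
    "HOL-Number_Theory.Cong"
    "HOL-Library.Landau_Symbols"
begin

section \<open>Entries of Pascal's triangle mod \<open>p\<close>\<close>

definition row_count :: "nat \<Rightarrow> nat \<Rightarrow> nat \<Rightarrow> nat" where
  "row_count p r u = card {j. j \<le> u \<and> [u choose j = r] (mod p)}"

definition residue_count :: "nat \<Rightarrow> nat \<Rightarrow> nat \<Rightarrow> nat" where
  "residue_count p r n = (\<Sum>u<n. row_count p r u)"

definition nonzero_count :: "nat \<Rightarrow> nat \<Rightarrow> nat" where
  "nonzero_count p n = card {(u, j). u < n \<and> j \<le> u \<and> \<not> [u choose j = 0] (mod p)}"


section \<open>Dirichlet characters\<close>

text \<open>A Dirichlet character is represented by its restriction to the natural numbers, which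
  determines it by periodicity. The value \<open>1\<close> at \<open>1\<close> follows from multiplicativity and
  the last condition.\<close>

definition dirichlet_character :: "nat \<Rightarrow> (nat \<Rightarrow> complex) \<Rightarrow> bool" where
  "dirichlet_character m \<psi> \<longleftrightarrow>
     (\<forall>a. \<psi> (a + m) = \<psi> a) \<and>
     (\<forall>a b. \<psi> (a * b) = \<psi> a * \<psi> b) \<and>
     (\<forall>a. \<psi> a = 0 \<longleftrightarrow> \<not> coprime a m)"

definition principal_character :: "nat \<Rightarrow> nat \<Rightarrow> complex" where
  "principal_character m a = (if coprime a m then 1 else 0)"

definition char_row_sum :: "(nat \<Rightarrow> complex) \<Rightarrow> nat \<Rightarrow> complex" where
  "char_row_sum \<psi> u = (\<Sum>j\<le>u. \<psi> (u choose j))"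

definition char_sum :: "(nat \<Rightarrow> complex) \<Rightarrow> nat \<Rightarrow> complex" where
  "char_sum \<psi> n = (\<Sum>u<n. char_row_sum \<psi> u)"

text \<open>Characters with \<open>char_sum \<psi> p = 0\<close> are left out: their logarithm is \<open>-\<infinity>\<close> by convention
  (whereas \<open>Ln 0 = 0\<close> in the library), which does not affect a maximum that includes \<open>1\<close>.\<close>

definition error_exponent :: "nat \<Rightarrow> real" where
  "error_exponent p =
     Max ({Re (Ln (char_sum \<psi> p) / of_real (ln (real p))) | \<psi>.
             dirichlet_character p \<psi> \<and> \<psi> \<noteq> principal_character p \<and> char_sum \<psi> p \<noteq> 0} \<union> {1})"


section \<open>Computable functions\<close>

text \<open>Partial recursive functions, presented by programs built from the basic functions by
  composition, primitive recursion and minimization. In \<open>Prec f g\<close> the recursion argument comes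
  first and the step function is applied to the previous index, the previous value and the
  parameters. Minimization requires all values before the first zero to be defined.\<close>

datatype recf = Zero | Succ | Proj nat | Comp recf "recf list" | Prec recf recf | Mu recf

inductive computes :: "recf \<Rightarrow> nat list \<Rightarrow> nat \<Rightarrow> bool" where
  computes_Zero: "computes Zero xs 0"
| computes_Succ: "computes Succ [x] (Suc x)"
| computes_Proj: "i < length xs \<Longrightarrow> computes (Proj i) xs (xs ! i)"
| computes_Comp: "list_all2 (\<lambda>g y. computes g xs y) gs ys \<Longrightarrow> computes f ys z
    \<Longrightarrow> computes (Comp f gs) xs z"
| computes_Prec_0: "computes f xs y \<Longrightarrow> computes (Prec f g) (0 # xs) y"
| computes_Prec_Suc: "computes (Prec f g) (k # xs) y \<Longrightarrow> computes g (k # y # xs) z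
    \<Longrightarrow> computes (Prec f g) (Suc k # xs) z"
| computes_Mu: "computes f (k # xs) 0 \<Longrightarrow> (\<forall>i<k. \<exists>y. computes f (i # xs) (Suc y))
    \<Longrightarrow> computes (Mu f) xs k"

definition computable2 :: "(nat \<Rightarrow> nat \<Rightarrow> nat) \<Rightarrow> bool" where
  "computable2 f \<longleftrightarrow> (\<exists>e. \<forall>x y z. computes e [x, y] z \<longleftrightarrow> z = f x y)"

end

theory Submission
  imports Defs "HOL-Number_Theory.Residue_Primitive_Roots"
begin

text \<open>Write \<open>T \<psi> u\<close> for \<^const>\<open>char_row_sum\<close> and \<open>\<phi> \<psi> n\<close> for \<^const>\<open>char_sum\<close>. Orthogonality of the
  Dirichlet characters modulo \<open>p\<close> (\<open>sum_dirichlet_characters\<close>) detects the residue \<open>r\<close>: if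
  \<open>r * s\<close> is \<open>1\<close> modulo \<open>p\<close>, then \<open>p - 1\<close> times the number of occurrences of \<open>r\<close> in the first
  \<open>n\<close> rows is the sum of \<open>\<psi> s * \<phi> \<psi> n\<close> over all characters \<open>\<psi>\<close>. The principal character
  contributes the number of nonzero entries, so the error is at most any common bound of the
  \<open>\<bar>\<phi> \<psi> n\<bar>\<close> with \<open>\<psi>\<close> nonprincipal.

  These sums are controlled by the self-similarity of the triangle. Lucas' congruence makes \<open>T \<psi>\<close>
  multiplicative over base-\<open>p\<close> digits, whence for \<open>d \<le> p\<close>
  \<open>\<phi> \<psi> (p * n + d) = \<phi> \<psi> p * \<phi> \<psi> n + T \<psi> n * \<phi> \<psi> d\<close> (\<open>char_sum_digit\<close>).
  Each new digit thus multiplies \<open>\<phi> \<psi>\<close> by \<open>\<phi> \<psi> p\<close>, up to a boundary term. Bounding the boundary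
  terms by \<open>\<bar>T \<psi> n\<bar> \<le> n + 1\<close> alone would cost a factor \<open>log n\<close> when \<open>\<bar>\<phi> \<psi> p\<bar> = p\<close>. Instead
  the combination \<open>\<bar>\<phi> \<psi> (n + 1)\<bar> + p\<^sup>2 * \<bar>T \<psi> n\<bar>\<close> is shown to grow by a factor of at most
  \<open>max p \<bar>\<phi> \<psi> p\<bar>\<close> per digit (\<open>potential_digit\<close>). For nonprincipal \<open>\<psi>\<close> this factor is at most
  \<open>p powr error_exponent p\<close>, so induction on the number of digits gives
  \<open>\<bar>\<phi> \<psi> n\<bar> \<le> 2 * p ^ 3 * n powr error_exponent p\<close>. The constant is at most \<open>p ^ 4\<close>, which a
  short primitive recursive program computes.\<close>

section \<open>Lucas' congruence\<close>

text \<open>This is one digit of Lucas' theorem. The induction on \<open>n\<close> uses Pascal's rule: within a block of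
  \<open>p\<close> rows it acts on the last digits only, and at a carry the interior entries vanish because \<open>p\<close>
  divides \<open>p choose j\<close> for \<open>0 < j < p\<close>, so that Pascal's rule passes to the leading parts.\<close>

lemma lucas_congruence:
  assumes p: "prime (p::nat)"
  shows "[n choose k = (n div p choose (k div p)) * (n mod p choose (k mod p))] (mod p)"
proof (induction n arbitrary: k)
  case 0
  show ?case
  proof (cases "k = 0")
    case False
    then have "k div p \<noteq> 0 \<or> k mod p \<noteq> 0"
      by (metis div_mod_decomp add.right_neutral mult_0)
    with False show ?thesis by (auto simp: binomial_eq_0)
  qed auto
next
  case (Suc n)
  have p1: "p > 1" using p prime_gt_1_nat by blast
  show ?case
  proof (cases k)
    case 0
    then show ?thesis by simp
  next
    case (Suc l)
    define q d t e where qd: "q = n div p" "d = n mod p" "t = l div p" "e = l mod p"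
    have d: "d < p" and e: "e < p" using p1 by (auto simp: qd)
    have n: "n = p * q + d" and l: "l = p * t + e" by (auto simp: qd)
    have IH: "[n choose j = (q choose (j div p)) * (d choose (j mod p))] (mod p)" for j
      using Suc.IH[of j] by (simp add: qd)
    have IHl: "[n choose l = (q choose t) * (d choose e)] (mod p)"
      using IH[of l] by (simp add: qd)
    have pascal: "Suc n choose k = (n choose l) + (n choose k)" by (simp add: Suc)
    have dn: "Suc n div p = (if Suc d = p then Suc q else q)"
             "Suc n mod p = (if Suc d = p then 0 else Suc d)"
      by (auto simp: qd div_Suc mod_Suc)
    have dk: "k div p = (if Suc e = p then Suc t else t)"
             "k mod p = (if Suc e = p then 0 else Suc e)"
      by (auto simp: qd Suc div_Suc mod_Suc)
    have "[Suc n choose k = (q choose t) * (d choose e) + (q choose (k div p)) * (d choose (k mod p))] (mod p)"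
      unfolding pascal by (intro cong_add IHl IH)
    also have "[(q choose t) * (d choose e) + (q choose (k div p)) * (d choose (k mod p))
       = (Suc n div p choose (k div p)) * (Suc n mod p choose (k mod p))] (mod p)"
    proof (cases "Suc d = p")
      case True
      show ?thesis
      proof (cases "Suc e = p")
        case True
        with \<open>Suc d = p\<close> have "d = e" by simp
        then show ?thesis using True by (simp add: dn dk)
      next
        case False
        have "p dvd p choose Suc e"
          using p e False by (intro dvd_choose_prime) auto
        moreover have "(q choose t) * (d choose e) + (q choose t) * (d choose Suc e) = (q choose t) * (p choose Suc e)"
          using True by (metis binomial_Suc_Suc distrib_left)
        ultimately show ?thesis using True False by (simp add: dn dk cong_0_iff)
      qed
    next
      case False
      show ?thesis
      proof (cases "Suc e = p")
        case True
        then have "d < e" using d False by linarith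
        then show ?thesis using True False by (simp add: dn dk binomial_eq_0)
      next
        case F: False
        have "(q choose t) * (d choose e) + (q choose t) * (d choose Suc e) = (q choose t) * (Suc d choose Suc e)"
          by (simp add: distrib_left)
        then show ?thesis using False F by (simp add: dn dk)
      qed
    qed
    finally show ?thesis .
  qed
qed

section \<open>Dirichlet characters of prime modulus\<close>

lemma dirichlet_character_mult: "dirichlet_character m \<psi> \<Longrightarrow> \<psi> (a * b) = \<psi> a * \<psi> b"
  by (simp add: dirichlet_character_def)

lemma dirichlet_character_eq_0_iff: "dirichlet_character m \<psi> \<Longrightarrow> \<psi> a = 0 \<longleftrightarrow> \<not> coprime a m"
  by (simp add: dirichlet_character_def)

lemma dirichlet_character_1:
  assumes "dirichlet_character m \<psi>"
  shows "\<psi> (Suc 0) = 1"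
proof -
  have "\<psi> 1 * \<psi> 1 = \<psi> 1" "\<psi> 1 \<noteq> 0"
    using dirichlet_character_mult[OF assms, of 1 1] dirichlet_character_eq_0_iff[OF assms, of 1] by simp_all
  then show ?thesis by simp
qed

lemma dirichlet_character_power:
  assumes "dirichlet_character m \<psi>"
  shows "\<psi> (a ^ k) = \<psi> a ^ k"
  by (induction k) (simp_all add: dirichlet_character_1[OF assms] dirichlet_character_mult[OF assms])

lemma dirichlet_character_cong:
  assumes "dirichlet_character m \<psi>" "[a = b] (mod m)"
  shows "\<psi> a = \<psi> b"
proof -
  have "\<psi> (c + k * m) = \<psi> c" for c k
  proof (induction k)
    case (Suc k)
    have "\<psi> (c + k * m + m) = \<psi> (c + k * m)"
      using assms(1) by (simp add: dirichlet_character_def)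
    then show ?case using Suc by (simp add: add_ac)
  qed simp
  then have "\<psi> (c mod m) = \<psi> c" for c
    using mod_mult_div_eq[of c m] by (metis mult.commute)
  with assms(2) show ?thesis unfolding cong_def by metis
qed

lemma dirichlet_character_principal: "dirichlet_character m (principal_character m)"
proof -
  have "coprime (a + m) m \<longleftrightarrow> coprime a m" for a by (simp add: coprime_iff_gcd_eq_1)
  then show ?thesis by (auto simp: dirichlet_character_def principal_character_def)
qed

lemma dirichlet_character_root_of_unity:
  assumes "dirichlet_character m \<psi>" "coprime a m"
  shows "\<psi> a ^ totient m = 1"
  using dirichlet_character_cong[OF assms(1) euler_theorem[OF assms(2)]]
  by (simp add: dirichlet_character_power[OF assms(1)] dirichlet_character_1[OF assms(1)])

lemma norm_dirichlet_character_le_1: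
  assumes "dirichlet_character m \<psi>" "m > 0"
  shows "norm (\<psi> a) \<le> 1"
proof (cases "coprime a m")
  case True
  have "norm (\<psi> a) ^ totient m = 1"
    using dirichlet_character_root_of_unity[OF assms(1) True] by (metis norm_one norm_power)
  then show ?thesis
    using assms(2) power_eq_imp_eq_base[of "norm (\<psi> a)" "totient m" 1] by simp
next
  case False
  then show ?thesis using dirichlet_character_eq_0_iff[OF assms(1), of a] by simp
qed

lemma power_mod_root_of_unity:
  fixes z :: "'a::monoid_mult"
  assumes "z ^ N = 1"
  shows "z ^ k = z ^ (k mod N)"
proof -
  have "z ^ k = z ^ (N * (k div N) + k mod N)" by simp
  also have "\<dots> = z ^ (k mod N)" unfolding power_add power_mult assms by simp
  finally show ?thesis .
qed

lemma residue_primroot_power_cong: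
  assumes m: "m > 1" and g: "residue_primroot m g" and a: "coprime a m"
  shows "\<exists>k. [g ^ k = a] (mod m)"
proof -
  have "coprime (a mod m) m" using m a by simp
  moreover from this have "a mod m \<noteq> 0" using m by (intro notI) simp
  ultimately have "a mod m \<in> totatives m"
    using m by (simp add: in_totatives_iff less_imp_le)
  also have "totatives m = (\<lambda>k. g ^ k mod m) ` {..<totient m}"
    using residue_primroot_is_generator[OF m g] by (simp add: bij_betw_def)
  finally show ?thesis by (auto simp: cong_def eq_commute)
qed

text \<open>The unit group is cyclic, so a character is determined by its value at a generator \<open>g\<close>, and every
  root of unity \<open>z\<close> of order dividing \<open>p - 1\<close> occurs as such a value: the exponent of a power of \<open>g\<close>
  is well defined modulo \<open>p - 1\<close>, and so \<open>g ^ k \<mapsto> z ^ k\<close> is a character.\<close>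

lemma bij_betw_characters_roots_of_unity:
  assumes p: "prime p" and g: "residue_primroot p g"
  shows "bij_betw (\<lambda>\<psi>. \<psi> g) {\<psi>. dirichlet_character p \<psi>} {z. z ^ (p - 1) = 1}"
proof -
  have p1: "p > 1" using p prime_gt_1_nat by blast
  have tot: "totient p = p - 1" using p by (rule totient_prime)
  have cop: "coprime g p" using g by (simp add: residue_primroot_def coprime_commute)
  have ord: "ord p g = p - 1" using g tot by (simp add: residue_primroot_def)
  note ex = residue_primroot_power_cong[OF p1 g]
  show ?thesis
  proof (rule bij_betwI')
    fix \<psi> \<psi>' assume "\<psi> \<in> {\<psi>. dirichlet_character p \<psi>}" "\<psi>' \<in> {\<psi>. dirichlet_character p \<psi>}"
    then have \<psi>: "dirichlet_character p \<psi>" and \<psi>': "dirichlet_character p \<psi>'" by auto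
    show "\<psi> g = \<psi>' g \<longleftrightarrow> \<psi> = \<psi>'"
    proof
      assume eq: "\<psi> g = \<psi>' g"
      show "\<psi> = \<psi>'"
      proof
        fix a
        show "\<psi> a = \<psi>' a"
        proof (cases "coprime a p")
          case True
          then obtain k where k: "[g ^ k = a] (mod p)" using ex by blast
          show ?thesis
            using dirichlet_character_cong[OF \<psi> k] dirichlet_character_cong[OF \<psi>' k] eq
            by (simp add: dirichlet_character_power[OF \<psi>] dirichlet_character_power[OF \<psi>'])
        next
          case False
          then show ?thesis using dirichlet_character_eq_0_iff[OF \<psi>] dirichlet_character_eq_0_iff[OF \<psi>'] by metis
        qed
      qed
    qed simp
  next
    fix \<psi> assume "\<psi> \<in> {\<psi>. dirichlet_character p \<psi>}"
    then show "\<psi> g \<in> {z. z ^ (p - 1) = 1}"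
      using dirichlet_character_root_of_unity[of p \<psi> g] cop tot by simp
  next
    fix z :: complex assume "z \<in> {z. z ^ (p - 1) = 1}"
    then have z: "z ^ (p - 1) = 1" by simp
    then have z0: "z \<noteq> 0" using p1 by (auto simp: power_0_left)
    have zcong: "z ^ i = z ^ j" if "[g ^ i = g ^ j] (mod p)" for i j
    proof -
      have "[i = j] (mod (p - 1))" using that order_divides_expdiff[of p g i j] cop ord
        by (simp add: coprime_commute)
      moreover have "z ^ k = z ^ (k mod (p - 1))" for k
        by (rule power_mod_root_of_unity[OF z])
      ultimately show ?thesis unfolding cong_def by metis
    qed
    define ind where "ind a = (SOME k. [g ^ k = a] (mod p))" for a
    have ind: "[g ^ ind a = a] (mod p)" if "coprime a p" for a
      unfolding ind_def using ex[OF that] by (rule someI_ex)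
    define \<psi> where "\<psi> a = (if coprime a p then z ^ ind a else 0)" for a
    have eval: "\<psi> a = z ^ k" if "[g ^ k = a] (mod p)" for a k
    proof -
      have "coprime a p" using that cop
        by (auto intro: cong_imp_coprime)
      moreover from ind[OF this] have "[g ^ ind a = g ^ k] (mod p)"
        using that cong_sym cong_trans by blast
      ultimately show ?thesis unfolding \<psi>_def using zcong by simp
    qed
    have "dirichlet_character p \<psi>"
      unfolding dirichlet_character_def
    proof (intro conjI allI)
      fix a
      show "\<psi> (a + p) = \<psi> a"
      proof (cases "coprime a p")
        case True
        have "[g ^ ind a = a + p] (mod p)" using ind[OF True] by (simp add: cong_def)
        then show ?thesis using eval ind[OF True] by metis
      qed (simp add: \<psi>_def coprime_iff_gcd_eq_1)
    next
      fix a b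
      show "\<psi> (a * b) = \<psi> a * \<psi> b"
      proof (cases "coprime a p \<and> coprime b p")
        case True
        then have "[g ^ (ind a + ind b) = a * b] (mod p)"
          unfolding power_add by (intro cong_mult ind) auto
        from eval[OF this] show ?thesis using True by (simp add: \<psi>_def power_add)
      qed (auto simp: \<psi>_def)
    next
      fix a show "(\<psi> a = 0) = (\<not> coprime a p)" using z0 by (simp add: \<psi>_def)
    qed
    moreover have "z = \<psi> g" using eval[of 1 g] by simp
    ultimately show "\<exists>\<psi>\<in>{\<psi>. dirichlet_character p \<psi>}. z = \<psi> g" by blast
  qed
qed

lemma finite_dirichlet_characters:
  assumes p: "prime p"
  shows "finite {\<psi>. dirichlet_character p \<psi>}" "card {\<psi>. dirichlet_character p \<psi>} = p - 1"
proof -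
  have p1: "p > 1" using p prime_gt_1_nat by blast
  obtain g where "residue_primroot p g" using prime_primitive_root_exists[OF p1 p] by blast
  note bij = bij_betw_characters_roots_of_unity[OF p this]
  show "finite {\<psi>. dirichlet_character p \<psi>}"
    using bij_betw_finite[OF bij] finite_roots_unity[of "p - 1"] p1 by auto
  show "card {\<psi>. dirichlet_character p \<psi>} = p - 1"
    using bij_betw_same_card[OF bij] card_roots_unity_eq[of "p - 1"] p1 by simp
qed

text \<open>When \<open>N\<close> does not divide \<open>m\<close>, multiplication by a primitive root of unity \<open>\<zeta>\<close> permutes the
  summation range but scales the sum by \<open>\<zeta> ^ m \<noteq> 1\<close>.\<close>

lemma sum_power_roots_of_unity:
  assumes "N > 0"
  shows "(\<Sum>z | z ^ N = 1. z ^ m) = (if N dvd m then of_nat N else (0::complex))"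
proof (cases "N dvd m")
  case True
  then obtain k where "m = N * k" by blast
  have "(\<Sum>z::complex | z ^ N = 1. z ^ m) = (\<Sum>z::complex | z ^ N = 1. 1)"
    unfolding \<open>m = N * k\<close> power_mult by (rule sum.cong) simp_all
  also have "\<dots> = of_nat N" using card_roots_unity_eq[OF assms] by simp
  finally show ?thesis using True by simp
next
  case False
  define \<zeta> where "\<zeta> = cis (2 * pi / N)"
  define S where "S = (\<Sum>z::complex | z ^ N = 1. z ^ m)"
  have \<zeta>N: "\<zeta> ^ N = 1" using assms by (simp add: \<zeta>_def Complex.DeMoivre)
  have \<zeta>0: "\<zeta> \<noteq> 0" by (simp add: \<zeta>_def)
  have "\<zeta> ^ m \<noteq> 1"
  proof
    assume "\<zeta> ^ m = 1"
    have "\<zeta> ^ m = \<zeta> ^ (m mod N)"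
      by (rule power_mod_root_of_unity[OF \<zeta>N])
    with \<open>\<zeta> ^ m = 1\<close> have "cis (2 * pi * real (m mod N) / real N) = cis (2 * pi * real 0 / real N)"
      by (simp add: \<zeta>_def Complex.DeMoivre mult_ac)
    then have "m mod N = 0"
      using Complex.bij_betw_roots_unity[OF assms] assms unfolding bij_betw_def
      by (elim conjE, drule_tac inj_onD) auto
    with False show False by (simp add: dvd_eq_mod_eq_0)
  qed
  have "S = (\<Sum>z::complex | z ^ N = 1. (\<zeta> * z) ^ m)"
    unfolding S_def
    by (rule sum.reindex_bij_witness[of _ "\<lambda>z. \<zeta> * z" "\<lambda>z. z / \<zeta>"])
       (auto simp: \<zeta>N \<zeta>0 power_mult_distrib power_divide)
  also have "\<dots> = \<zeta> ^ m * S" by (simp add: S_def power_mult_distrib sum_distrib_left)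
  finally have "S = 0" using \<open>\<zeta> ^ m \<noteq> 1\<close> by simp
  then show ?thesis using False by (simp add: S_def)
qed

text \<open>If \<open>a\<close> is congruent to \<open>g ^ k\<close> for a primitive root \<open>g\<close>, this is the sum of the \<open>k\<close>-th powers of
  the roots of unity \<open>\<psi> g\<close>.\<close>

lemma sum_dirichlet_characters:
  assumes p: "prime p"
  shows "(\<Sum>\<psi> | dirichlet_character p \<psi>. \<psi> a) = (if [a = 1] (mod p) then of_nat (p - 1) else 0)"
proof (cases "coprime a p")
  case False
  then have "\<not> [a = 1] (mod p)" using cong_imp_coprime[of 1 a p] cong_sym by auto
  moreover have "(\<Sum>\<psi> | dirichlet_character p \<psi>. \<psi> a) = 0"
    using False by (intro sum.neutral) (auto simp: dirichlet_character_eq_0_iff)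
  ultimately show ?thesis by simp
next
  case True
  have p1: "p > 1" using p prime_gt_1_nat by blast
  obtain g where g: "residue_primroot p g" using prime_primitive_root_exists[OF p1 p] by blast
  have ord: "ord p g = p - 1" using g p by (simp add: residue_primroot_def totient_prime)
  obtain k where k: "[g ^ k = a] (mod p)" using residue_primroot_power_cong[OF p1 g True] by blast
  have "(\<Sum>\<psi> | dirichlet_character p \<psi>. \<psi> a) = (\<Sum>\<psi> | dirichlet_character p \<psi>. \<psi> g ^ k)"
    using dirichlet_character_cong[OF _ k] by (intro sum.cong refl) (simp add: dirichlet_character_power)
  also have "\<dots> = (\<Sum>z | z ^ (p - 1) = 1. z ^ k)"
    by (rule sum.reindex_bij_betw[OF bij_betw_characters_roots_of_unity[OF p g]])
  also have "\<dots> = (if p - 1 dvd k then of_nat (p - 1) else 0)"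
    using p1 by (intro sum_power_roots_of_unity) simp
  also have "p - 1 dvd k \<longleftrightarrow> [a = 1] (mod p)"
    using ord_divides[of g k p] k ord by (simp add: cong_def)
  finally show ?thesis .
qed

section \<open>Character sums over Pascal's triangle\<close>

lemma char_row_sum_extend:
  assumes "dirichlet_character m \<psi>" "m > 1" "u < N"
  shows "char_row_sum \<psi> u = (\<Sum>j<N. \<psi> (u choose j))"
  unfolding char_row_sum_def using assms
  by (intro sum.mono_neutral_left)
     (auto simp: dirichlet_character_eq_0_iff binomial_eq_0)

lemma sum_lessThan_mult:
  fixes f :: "nat \<Rightarrow> 'a::comm_monoid_add"
  shows "(\<Sum>k<n * q. f k) = (\<Sum>i<n. \<Sum>j<q. f (q * i + j))"
proof -
  have "sum f {i * q..<i * q + q} = (\<Sum>j<q. f (q * i + j))" for i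
    using sum.shift_bounds_nat_ivl[of f 0 "i * q" q] by (simp add: atLeast0LessThan add.commute mult.commute)
  then show ?thesis by (simp flip: sum.nat_group)
qed

text \<open>Extending row \<open>p * n + d\<close> by zeros to a length of \<open>(n + 1) * p\<close>, one splits the column index into
  its last digit \<open>j\<close> and the rest \<open>i\<close>; Lucas' congruence then factors the double sum.\<close>

lemma char_row_sum_digit:
  assumes p: "prime p" and \<psi>: "dirichlet_character p \<psi>" and d: "d < p"
  shows "char_row_sum \<psi> (p * n + d) = char_row_sum \<psi> n * char_row_sum \<psi> d"
proof -
  have p1: "p > 1" using p prime_gt_1_nat by blast
  have "p * n + d < Suc n * p" using d by simp
  then have "char_row_sum \<psi> (p * n + d) = (\<Sum>i<Suc n. \<Sum>j<p. \<psi> ((p * n + d) choose (p * i + j)))"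
    by (subst char_row_sum_extend[OF \<psi> p1]) (auto simp only: sum_lessThan_mult)
  also have "\<dots> = (\<Sum>i<Suc n. \<Sum>j<p. \<psi> (n choose i) * \<psi> (d choose j))"
  proof (intro sum.cong refl)
    fix i j assume "j \<in> {..<p}"
    then show "\<psi> ((p * n + d) choose (p * i + j)) = \<psi> (n choose i) * \<psi> (d choose j)"
      using dirichlet_character_cong[OF \<psi> lucas_congruence[OF p, of "p * n + d" "p * i + j"]] d
      by (simp add: dirichlet_character_mult[OF \<psi>])
  qed
  also have "\<dots> = char_row_sum \<psi> n * char_row_sum \<psi> d"
    by (simp add: char_row_sum_extend[OF \<psi> p1, of n "Suc n"] char_row_sum_extend[OF \<psi> p1 d]
        sum_product del: sum.lessThan_Suc)
  finally show ?thesis .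
qed

lemma char_sum_digit:
  assumes p: "prime p" and \<psi>: "dirichlet_character p \<psi>" and d: "d \<le> p"
  shows "char_sum \<psi> (p * n + d) = char_sum \<psi> p * char_sum \<psi> n + char_row_sum \<psi> n * char_sum \<psi> d"
proof -
  have "char_sum \<psi> (p * n + d) = (\<Sum>u<n * p. char_row_sum \<psi> u) + (\<Sum>j<d. char_row_sum \<psi> (p * n + j))"
    unfolding char_sum_def
    by (induction d) (simp_all add: mult.commute add.assoc)
  also have "(\<Sum>u<n * p. char_row_sum \<psi> u) = (\<Sum>i<n. \<Sum>j<p. char_row_sum \<psi> i * char_row_sum \<psi> j)"
    unfolding sum_lessThan_mult by (intro sum.cong refl char_row_sum_digit[OF p \<psi>]) simp
  also have "(\<Sum>j<d. char_row_sum \<psi> (p * n + j)) = (\<Sum>j<d. char_row_sum \<psi> n * char_row_sum \<psi> j)"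
    using d by (intro sum.cong refl char_row_sum_digit[OF p \<psi>]) simp
  also have "(\<Sum>i<n. \<Sum>j<p. char_row_sum \<psi> i * char_row_sum \<psi> j) = char_sum \<psi> n * char_sum \<psi> p"
    by (simp add: char_sum_def sum_product)
  also have "(\<Sum>j<d. char_row_sum \<psi> n * char_row_sum \<psi> j) = char_row_sum \<psi> n * char_sum \<psi> d"
    by (simp add: char_sum_def sum_distrib_left)
  finally show ?thesis by (simp only: mult.commute)
qed

lemma norm_char_row_sum_le:
  assumes \<psi>: "dirichlet_character m \<psi>" "m > 0"
  shows "norm (char_row_sum \<psi> u) \<le> real u + 1"
proof -
  have "norm (char_row_sum \<psi> u) \<le> (\<Sum>j\<le>u. 1)"
    unfolding char_row_sum_def
    by (rule order_trans[OF norm_sum sum_mono]) (rule norm_dirichlet_character_le_1[OF \<psi>])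
  then show ?thesis by simp
qed

lemma norm_char_sum_diff_le:
  assumes \<psi>: "dirichlet_character p \<psi>" "p > 0" and "m \<le> p"
  shows "norm (char_sum \<psi> p - char_sum \<psi> m) \<le> (real p)\<^sup>2"
proof -
  have "char_sum \<psi> p - char_sum \<psi> m = (\<Sum>u\<in>{m..<p}. char_row_sum \<psi> u)"
    unfolding char_sum_def using \<open>m \<le> p\<close> by (simp add: sum_diff_nat_ivl flip: atLeast0LessThan)
  also have "norm \<dots> \<le> (\<Sum>u\<in>{m..<p}. real p)"
    using norm_char_row_sum_le[OF \<psi>]
    by (intro order_trans[OF norm_sum sum_mono]) (smt (verit) atLeastLessThan_iff of_nat_less_iff nat_less_real_le)
  also have "\<dots> \<le> real p * real p" by (simp add: mult_right_mono)
  finally show ?thesis by (simp add: power2_eq_square)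
qed

text \<open>The character sum is taken up to \<open>Suc n\<close> rather than \<open>n\<close> because of the last digit \<open>p - 1\<close>: row
  \<open>p - 1\<close> consists of \<open>\<plusminus>1\<close> modulo \<open>p\<close>, so its row sum may have absolute value \<open>p\<close> and appending
  this digit can multiply the second summand by \<open>p\<close>, leaving no room for a boundary term. Counting
  row \<open>n\<close> itself makes the boundary term vanish for this digit, as
  \<open>Suc (p * n + (p - 1)) = p * Suc n\<close>.\<close>

definition potential :: "nat \<Rightarrow> (nat \<Rightarrow> complex) \<Rightarrow> nat \<Rightarrow> real" where
  "potential p \<psi> n = norm (char_sum \<psi> (Suc n)) + (real p)\<^sup>2 * norm (char_row_sum \<psi> n)"

text \<open>Measured from the right end \<open>p * Suc n\<close> of the block, the boundary term is, up to sign, the row sum at \<open>n\<close> times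
  the sum of the row sums from \<open>d + 1\<close> to \<open>p - 1\<close>. For \<open>d = p - 1\<close> it is zero. For any other \<open>d\<close>
  the row sum at \<open>d\<close> is at most \<open>p - 1\<close>, so the second summand of the potential grows by \<open>p - 1\<close>
  only; the spare \<open>p\<^sup>2\<close> times the row sum at \<open>n\<close> absorbs the boundary term. This is what the
  weight \<open>p\<^sup>2\<close> is for.\<close>

lemma potential_digit:
  assumes p: "prime p" and \<psi>: "dirichlet_character p \<psi>" and d: "d < p"
  shows "potential p \<psi> (p * n + d) \<le> max (real p) (norm (char_sum \<psi> p)) * potential p \<psi> n"
proof -
  have p0: "p > 0" using d by simp
  define L where "L = max (real p) (norm (char_sum \<psi> p))"
  have row: "char_row_sum \<psi> (p * n + d) = char_row_sum \<psi> n * char_row_sum \<psi> d"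
    by (rule char_row_sum_digit[OF p \<psi> d])
  have d_le: "norm (char_row_sum \<psi> d) \<le> real d + 1" by (rule norm_char_row_sum_le[OF \<psi> p0])
  have "char_sum \<psi> (Suc (p * n + d)) = char_sum \<psi> p * char_sum \<psi> n + char_row_sum \<psi> n * char_sum \<psi> (Suc d)"
    using char_sum_digit[OF p \<psi>, of "Suc d" n] d by simp
  then have cs: "char_sum \<psi> (Suc (p * n + d)) =
      char_sum \<psi> p * char_sum \<psi> (Suc n) - char_row_sum \<psi> n * (char_sum \<psi> p - char_sum \<psi> (Suc d))"
    by (simp add: char_sum_def algebra_simps)
  have le: "norm (char_sum \<psi> (Suc (p * n + d))) \<le>
      L * norm (char_sum \<psi> (Suc n)) + norm (char_row_sum \<psi> n) * norm (char_sum \<psi> p - char_sum \<psi> (Suc d))"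
  proof -
    have "norm (char_sum \<psi> p * char_sum \<psi> (Suc n)) \<le> L * norm (char_sum \<psi> (Suc n))"
      by (simp add: norm_mult L_def mult_right_mono)
    then show ?thesis unfolding cs
      by (smt (verit) norm_triangle_ineq4 norm_mult)
  qed
  have "norm (char_sum \<psi> p - char_sum \<psi> (Suc d)) + (real p)\<^sup>2 * norm (char_row_sum \<psi> d) \<le> (real p)\<^sup>2 * real p"
  proof (cases "Suc d = p")
    case True
    then have "real d + 1 = real p" by linarith
    then have "(real p)\<^sup>2 * norm (char_row_sum \<psi> d) \<le> (real p)\<^sup>2 * real p"
      using d_le by (intro mult_left_mono) auto
    with True show ?thesis by simp
  next
    case False
    then have "norm (char_row_sum \<psi> d) \<le> real p - 1" using d d_le by linarith
    then have "(real p)\<^sup>2 * norm (char_row_sum \<psi> d) \<le> (real p)\<^sup>2 * (real p - 1)"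
      by (intro mult_left_mono) auto
    moreover have "norm (char_sum \<psi> p - char_sum \<psi> (Suc d)) \<le> (real p)\<^sup>2"
      using d by (intro norm_char_sum_diff_le[OF \<psi> p0]) simp
    ultimately show ?thesis by (simp add: algebra_simps)
  qed
  also have "\<dots> \<le> (real p)\<^sup>2 * L" by (intro mult_left_mono) (auto simp: L_def)
  finally have "norm (char_row_sum \<psi> n) * (norm (char_sum \<psi> p - char_sum \<psi> (Suc d)) + (real p)\<^sup>2 * norm (char_row_sum \<psi> d))
      \<le> norm (char_row_sum \<psi> n) * ((real p)\<^sup>2 * L)"
    by (intro mult_left_mono) auto
  with le show ?thesis unfolding L_def[symmetric] potential_def row norm_mult
    by (simp add: algebra_simps)
qed

text \<open>The constant comes from the numbers with a single digit, where each of the two summands of the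
  potential is at most \<open>p ^ 3\<close>. Removing the last digit of \<open>n\<close> costs a factor of at most
  \<open>p powr \<theta>\<close>, and \<open>p * (n div p) \<le> n\<close>.\<close>

lemma potential_le:
  assumes p: "prime p" and \<psi>: "dirichlet_character p \<psi>"
    and \<theta>: "\<theta> \<ge> 1" "norm (char_sum \<psi> p) \<le> real p powr \<theta>"
    and "n \<ge> 1"
  shows "potential p \<psi> n \<le> 2 * real p ^ 3 * real n powr \<theta>"
  using \<open>n \<ge> 1\<close>
proof (induction n rule: less_induct)
  case (less n)
  have p1: "p > 1" using p prime_gt_1_nat by blast
  show ?case
  proof (cases "n < p")
    case True
    have "norm (char_sum \<psi> (Suc n)) = norm (\<Sum>u<Suc n. char_row_sum \<psi> u)"
      by (simp only: char_sum_def)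
    also have "\<dots> \<le> (\<Sum>u<Suc n. real p)"
    proof (intro order_trans[OF norm_sum sum_mono])
      fix u assume "u \<in> {..<Suc n}"
      then have "real u + 1 \<le> real p" using True by simp
      then show "norm (char_row_sum \<psi> u) \<le> real p"
        using norm_char_row_sum_le[OF \<psi>, of u] p1 by simp
    qed
    also have "\<dots> \<le> real p * real p" using True by (auto intro!: mult_right_mono)
    also have "\<dots> \<le> real p ^ 3" using p1 by (simp add: power3_eq_cube)
    finally have 1: "norm (char_sum \<psi> (Suc n)) \<le> real p ^ 3" .
    have "norm (char_row_sum \<psi> n) \<le> real p"
      using norm_char_row_sum_le[OF \<psi>, of n] p1 True by simp
    then have "(real p)\<^sup>2 * norm (char_row_sum \<psi> n) \<le> (real p)\<^sup>2 * real p" by (intro mult_left_mono) auto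
    with 1 have "potential p \<psi> n \<le> 2 * real p ^ 3 * 1"
      by (simp add: potential_def power2_eq_square power3_eq_cube)
    also have "\<dots> \<le> 2 * real p ^ 3 * real n powr \<theta>"
      using less.prems \<theta> by (intro mult_left_mono ge_one_powr_ge_zero) auto
    finally show ?thesis .
  next
    case False
    define m where "m = n div p"
    have m: "m \<ge> 1" "m < n" using False p1 by (auto simp: m_def Suc_le_eq div_greater_zero_iff)
    have n: "n = p * m + n mod p" by (simp add: m_def)
    have "real p \<le> real p powr \<theta>" using powr_mono[OF \<theta>(1), of "real p"] p1 by simp
    then have L: "max (real p) (norm (char_sum \<psi> p)) \<le> real p powr \<theta>" using \<theta>(2) by simp
    have "potential p \<psi> n \<le> max (real p) (norm (char_sum \<psi> p)) * potential p \<psi> m"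
      by (subst n) (rule potential_digit[OF p \<psi>], use p1 in simp)
    also have "\<dots> \<le> real p powr \<theta> * (2 * real p ^ 3 * real m powr \<theta>)"
      using L less.IH[OF m(2,1)] by (intro mult_mono) (auto simp: potential_def)
    also have "\<dots> = 2 * real p ^ 3 * real (p * m) powr \<theta>" by (simp add: powr_mult)
    also have "\<dots> \<le> 2 * real p ^ 3 * real n powr \<theta>"
      using n \<theta>(1) by (intro mult_left_mono powr_mono2) (auto simp flip: of_nat_mult)
    finally show ?thesis .
  qed
qed

lemma norm_char_sum_le:
  assumes p: "prime p" and \<psi>: "dirichlet_character p \<psi>"
    and \<theta>: "\<theta> \<ge> 1" "norm (char_sum \<psi> p) \<le> real p powr \<theta>"
    and "n \<ge> 1"
  shows "norm (char_sum \<psi> n) \<le> 2 * real p ^ 3 * real n powr \<theta>"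
proof (cases "n = 1")
  case True
  have "p > 1" using p prime_gt_1_nat by blast
  then have "1 * 1 \<le> 2 * real p ^ 3" by (intro mult_mono) auto
  then show ?thesis using True by (simp add: char_sum_def char_row_sum_def dirichlet_character_1[OF \<psi>])
next
  case False
  with \<open>n \<ge> 1\<close> obtain m where m: "n = Suc m" "m \<ge> 1" by (cases n) auto
  have "norm (char_sum \<psi> n) \<le> potential p \<psi> m" by (simp add: potential_def m)
  also have "\<dots> \<le> 2 * real p ^ 3 * real m powr \<theta>" by (rule potential_le[OF p \<psi> \<theta> m(2)])
  also have "\<dots> \<le> 2 * real p ^ 3 * real n powr \<theta>"
    using m \<theta>(1) by (intro mult_left_mono powr_mono2) auto
  finally show ?thesis .
qed

lemma error_exponent_bounds:
  assumes p: "prime p"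
  shows "error_exponent p \<ge> 1"
    and "dirichlet_character p \<psi> \<Longrightarrow> \<psi> \<noteq> principal_character p
      \<Longrightarrow> norm (char_sum \<psi> p) \<le> real p powr error_exponent p"
proof -
  have p1: "p > 1" using p prime_gt_1_nat by blast
  \<comment> \<open>\<^const>\<open>Max\<close> bounds its elements only on a finite set; here finiteness comes from the finite
    number of characters.\<close>
  define f where "f \<psi> = Re (Ln (char_sum \<psi> p) / of_real (ln (real p)))" for \<psi>
  define E where "E = {f \<psi> | \<psi>. dirichlet_character p \<psi> \<and> \<psi> \<noteq> principal_character p \<and> char_sum \<psi> p \<noteq> 0} \<union> {1}"
  have ee: "error_exponent p = Max E" by (simp add: error_exponent_def E_def f_def)
  have "E \<subseteq> f ` {\<psi>. dirichlet_character p \<psi>} \<union> {1}" by (auto simp: E_def)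
  then have fin: "finite E" by (rule finite_subset) (simp add: finite_dirichlet_characters[OF p])
  show "error_exponent p \<ge> 1" unfolding ee by (rule Max_ge[OF fin]) (simp add: E_def)
  assume \<psi>: "dirichlet_character p \<psi>" "\<psi> \<noteq> principal_character p"
  show "norm (char_sum \<psi> p) \<le> real p powr error_exponent p"
  proof (cases "char_sum \<psi> p = 0")
    case False
    have "f \<psi> \<le> error_exponent p" unfolding ee by (rule Max_ge[OF fin]) (use \<psi> False in \<open>auto simp: E_def\<close>)
    moreover have "f \<psi> = log (real p) (norm (char_sum \<psi> p))"
      using False by (simp add: f_def log_def Re_divide_of_real)
    ultimately show ?thesis using p1 False by (simp add: log_le_iff)
  qed simp
qed

section \<open>Counting residues\<close>

lemma nonzero_count_eq_char_sum:
  assumes p: "prime p"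
  shows "of_nat (nonzero_count p n) = char_sum (principal_character p) n"
proof -
  have cop: "coprime a p \<longleftrightarrow> \<not> [a = 0] (mod p)" for a
    using prime_imp_coprime[OF p, of a] p by (auto simp: cong_0_iff coprime_commute dest: coprime_common_divisor_nat prime_gt_1_nat)
  have "{(u, j). u < n \<and> j \<le> u \<and> \<not> [u choose j = 0] (mod p)} =
      (SIGMA u:{..<n}. {j. j \<le> u \<and> \<not> [u choose j = 0] (mod p)})" by auto
  then have "nonzero_count p n = (\<Sum>u<n. card {j \<in> {..u}. \<not> [u choose j = 0] (mod p)})"
    unfolding nonzero_count_def by (simp add: card_SigmaI)
  also have "of_nat \<dots> = char_sum (principal_character p) n"
    unfolding char_sum_def char_row_sum_def principal_character_def cop of_nat_sum
    by (simp add: sum.If_cases Int_def)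
  finally show ?thesis .
qed

text \<open>Multiplying an entry by the inverse \<open>s\<close> of \<open>r\<close> turns the test for the residue \<open>r\<close> into the test for
  the residue \<open>1\<close>, which the sum over all characters performs.\<close>

lemma residue_count_eq_sum_characters:
  assumes p: "prime p" and s: "[r * s = 1] (mod p)"
  shows "of_nat (p - 1) * of_nat (residue_count p r n)
     = (\<Sum>\<psi> | dirichlet_character p \<psi>. \<psi> s * char_sum \<psi> n)"
proof -
  have inv: "[s * c = 1] (mod p) \<longleftrightarrow> [c = r] (mod p)" for c
  proof
    assume "[s * c = 1] (mod p)"
    then have "[r * (s * c) = r * 1] (mod p)" by (intro cong_mult cong_refl)
    moreover have "[r * s * c = 1 * c] (mod p)" by (intro cong_mult s cong_refl)
    ultimately show "[c = r] (mod p)" by (simp add: mult.assoc) (metis cong_sym cong_trans)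
  next
    assume "[c = r] (mod p)"
    then have "[s * c = s * r] (mod p)" by (intro cong_mult cong_refl)
    then show "[s * c = 1] (mod p)" using s by (metis cong_trans mult.commute)
  qed
  have "(\<Sum>\<psi> | dirichlet_character p \<psi>. \<psi> s * char_sum \<psi> n)
     = (\<Sum>\<psi> | dirichlet_character p \<psi>. \<Sum>u<n. \<Sum>j\<le>u. \<psi> (s * (u choose j)))"
    by (intro sum.cong refl) (simp add: char_sum_def char_row_sum_def sum_distrib_left dirichlet_character_mult)
  also have "\<dots> = (\<Sum>u<n. \<Sum>j\<le>u. \<Sum>\<psi> | dirichlet_character p \<psi>. \<psi> (s * (u choose j)))"
    by (subst sum.swap, intro sum.cong refl, rule sum.swap)
  also have "\<dots> = (\<Sum>u<n. \<Sum>j\<le>u. if [u choose j = r] (mod p) then of_nat (p - 1) else 0)"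
    by (simp only: sum_dirichlet_characters[OF p] inv)
  also have "\<dots> = (\<Sum>u<n. of_nat (p - 1) * of_nat (row_count p r u))"
    by (intro sum.cong refl) (simp add: row_count_def sum.If_cases Int_def)
  finally show ?thesis by (simp add: residue_count_def sum_distrib_left)
qed

text \<open>There are \<open>p - 2\<close> nonprincipal characters, so the division by \<open>p - 1\<close> turns the sum of their
  contributions into at most the common bound for a single one.\<close>

theorem residue_count_error_bound:
  assumes p: "prime p" and r: "\<not> [r = 0] (mod p)" and n: "n \<ge> 1"
  shows "\<bar>real (residue_count p r n) - real (nonzero_count p n) / (real p - 1)\<bar>
           \<le> 2 * real p ^ 3 * real n powr error_exponent p"
proof -
  have p1: "p > 1" using p prime_gt_1_nat by blast
  define X where "X = {\<psi>. dirichlet_character p \<psi>}"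
  define \<psi>0 where "\<psi>0 = principal_character p"
  define B where "B = 2 * real p ^ 3 * real n powr error_exponent p"
  have X: "finite X" "card X = p - 1" "\<psi>0 \<in> X"
    using finite_dirichlet_characters[OF p] dirichlet_character_principal by (auto simp: X_def \<psi>0_def)
  have "coprime r p" using r prime_imp_coprime[OF p, of r] by (simp add: cong_0_iff coprime_commute)
  then obtain s where s: "[r * s = 1] (mod p)" using cong_solve_coprime_nat by auto
  have "coprime (r * s) p" using cong_imp_coprime[OF cong_sym[OF s]] by simp
  then have \<psi>0s: "\<psi>0 s = 1" by (simp add: \<psi>0_def principal_character_def)
  have "of_nat (p - 1) * of_nat (residue_count p r n) = (\<Sum>\<psi>\<in>X. \<psi> s * char_sum \<psi> n)"
    unfolding X_def by (rule residue_count_eq_sum_characters[OF p s])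
  also have "\<dots> = of_nat (nonzero_count p n) + (\<Sum>\<psi>\<in>X - {\<psi>0}. \<psi> s * char_sum \<psi> n)"
    by (subst sum.remove[OF X(1,3)]) (simp add: \<psi>0s nonzero_count_eq_char_sum[OF p] flip: \<psi>0_def)
  finally have "complex_of_real (real (p - 1) * real (residue_count p r n) - real (nonzero_count p n))
      = (\<Sum>\<psi>\<in>X - {\<psi>0}. \<psi> s * char_sum \<psi> n)" by simp
  then have "\<bar>real (p - 1) * real (residue_count p r n) - real (nonzero_count p n)\<bar>
      = norm (\<Sum>\<psi>\<in>X - {\<psi>0}. \<psi> s * char_sum \<psi> n)" by (metis norm_of_real)
  also have "\<dots> \<le> (\<Sum>\<psi>\<in>X - {\<psi>0}. 1 * B)"
  proof (intro order_trans[OF norm_sum sum_mono])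
    fix \<psi> assume "\<psi> \<in> X - {\<psi>0}"
    then have \<psi>: "dirichlet_character p \<psi>" "\<psi> \<noteq> principal_character p" by (auto simp: X_def \<psi>0_def)
    show "norm (\<psi> s * char_sum \<psi> n) \<le> 1 * B"
      unfolding norm_mult B_def
      using p1 by (intro mult_mono norm_dirichlet_character_le_1[OF \<psi>(1)]
          norm_char_sum_le[OF p \<psi>(1) error_exponent_bounds(1)[OF p] error_exponent_bounds(2)[OF p \<psi>] n]) auto
  qed
  also have "\<dots> \<le> real (p - 1) * B"
    using X by (simp add: B_def mult_right_mono)
  finally have "\<bar>real (p - 1) * real (residue_count p r n) - real (nonzero_count p n)\<bar> / real (p - 1) \<le> B"
    using p1 by (simp add: divide_le_eq mult.commute)
  also have "\<bar>real (p - 1) * real (residue_count p r n) - real (nonzero_count p n)\<bar> / real (p - 1)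
      = \<bar>(real (p - 1) * real (residue_count p r n) - real (nonzero_count p n)) / real (p - 1)\<bar>"
    by simp
  also have "(real (p - 1) * real (residue_count p r n) - real (nonzero_count p n)) / real (p - 1)
      = real (residue_count p r n) - real (nonzero_count p n) / (real p - 1)"
    using p1 by (simp add: diff_divide_distrib of_nat_diff)
  finally show ?thesis by (simp add: B_def)
qed

section \<open>Computability of the constant\<close>

text \<open>\<^const>\<open>computable2\<close> asks for a program whose only result is the required value, whereas the
  introduction rules of \<^const>\<open>computes\<close> only show that it is a result; determinism closes the gap.\<close>

lemma computes_deterministic:
  "computes e xs y \<Longrightarrow> computes e xs z \<Longrightarrow> y = z"
proof (induction arbitrary: z rule: computes.induct)
  case (computes_Comp xs gs ys f y)
  from computes_Comp.prems obtain ys' where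
    ys': "list_all2 (\<lambda>g y. computes g xs y) gs ys'" "computes f ys' z"
    by (cases rule: computes.cases) auto
  have "ys = ys'"
    using computes_Comp.IH(1) ys'(1) by (auto simp: list_all2_conv_all_nth intro!: nth_equalityI)
  then show ?case using computes_Comp.IH(2) ys'(2) by simp
next
  case (computes_Prec_Suc f g k xs y z')
  from computes_Prec_Suc.prems obtain y' where
    "computes (Prec f g) (k # xs) y'" "computes g (k # y' # xs) z"
    by (cases rule: computes.cases) auto
  then show ?case using computes_Prec_Suc.IH by blast
next
  case (computes_Mu f k xs)
  from computes_Mu.prems have
    z: "computes f (z # xs) 0" "\<forall>i<z. \<exists>y. computes f (i # xs) (Suc y)"
    by (cases rule: computes.cases; auto)+
  have "\<not> k < z" using computes_Mu.IH(1) z(2) by fastforce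
  moreover have "\<not> z < k" using computes_Mu.IH(2) z(1) by fastforce
  ultimately show ?case by simp
qed (erule computes.cases; simp)+

lemma computes_Proj_nth: "i < length xs \<Longrightarrow> xs ! i = y \<Longrightarrow> computes (Proj i) xs y"
  using computes_Proj by blast

definition add_recf :: recf where
  "add_recf = Prec (Proj 0) (Comp Succ [Proj 1])"

definition mult_recf :: recf where
  "mult_recf = Prec Zero (Comp add_recf [Proj 1, Proj 2])"

lemma computes_add_recf: "computes add_recf [k, x] (k + x)"
  unfolding add_recf_def
proof (induction k)
  case 0
  show ?case by (auto intro!: computes.intros computes_Proj_nth)
next
  case (Suc k)
  show ?case
    by (rule computes_Prec_Suc[OF Suc], rule computes_Comp[where ys = "[k + x]"])
       (auto intro!: computes_Proj_nth computes_Succ)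
qed

lemma computes_mult_recf: "computes mult_recf [k, x] (k * x)"
  unfolding mult_recf_def
proof (induction k)
  case 0
  show ?case by (auto intro!: computes.intros)
next
  case (Suc k)
  show ?case
    by (rule computes_Prec_Suc[OF Suc], rule computes_Comp[where ys = "[k * x, x]"])
       (use computes_add_recf[of "k * x" x] in \<open>auto intro!: computes_Proj_nth simp: add.commute\<close>)
qed

lemma computable2_fourth_power: "computable2 (\<lambda>p r. p ^ 4)"
proof -
  define square where "square = Comp mult_recf [Proj 0, Proj 0]"
  have square: "computes square (x # xs) (x * x)" for x xs
    unfolding square_def
    by (rule computes_Comp[where ys = "[x, x]"]) (auto intro!: computes_Proj_nth computes_mult_recf)
  have "computes (Comp square [square]) [x, y] (x ^ 4)" for x y
    by (rule computes_Comp[where ys = "[x * x]"])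
       (use square[of x "[y]"] square[of "x * x" "[]"] in \<open>auto simp: power4_eq_xxxx mult.assoc\<close>)
  then show ?thesis
    unfolding computable2_def using computes_deterministic by blast
qed

theorem theorem1p3:
  shows "(\<forall>p r :: nat. prime p \<longrightarrow> \<not> [r = 0] (mod p) \<longrightarrow>
            (\<lambda>n. real (residue_count p r n) - real (nonzero_count p n) / (real p - 1))
              \<in> O(\<lambda>n. real n powr error_exponent p))
       \<and> (\<exists>C :: nat \<Rightarrow> nat \<Rightarrow> nat. computable2 C \<and>
            (\<forall>p r :: nat. prime p \<longrightarrow> \<not> [r = 0] (mod p) \<longrightarrow>
              (\<forall>n\<ge>1. \<bar>real (residue_count p r n) - real (nonzero_count p n) / (real p - 1)\<bar>
                       \<le> real (C p r) * real n powr error_exponent p)))"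
proof (intro conjI allI impI exI[of _ "\<lambda>p r. p ^ 4"])
  fix p r :: nat
  assume p: "prime p" and r: "\<not> [r = 0] (mod p)"
  show "(\<lambda>n. real (residue_count p r n) - real (nonzero_count p n) / (real p - 1))
          \<in> O(\<lambda>n. real n powr error_exponent p)"
    by (rule bigoI[of _ "2 * real p ^ 3"], rule eventually_sequentiallyI[of 1])
       (use residue_count_error_bound[OF p r] in simp)
  fix n :: nat assume "1 \<le> n"
  note residue_count_error_bound[OF p r this]
  also have "2 * real p ^ 3 * real n powr error_exponent p \<le> real (p ^ 4) * real n powr error_exponent p"
    using prime_ge_2_nat[OF p] by (intro mult_right_mono) (auto simp: numeral_eq_Suc)
  finally show "\<bar>real (residue_count p r n) - real (nonzero_count p n) / (real p - 1)\<bar>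
      \<le> real (p ^ 4) * real n powr error_exponent p" .
qed (rule computable2_fourth_power)

end
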